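(* Let $X$ be a finite rack with $|X|=m$, let $n\ge 1$, and let $B$ be an $n$-braid. The rack counting matrix of $B$ is an invariant of $B$: if $w$ and $w'$ are two braid words (diagrams) representing the same $n$-braid, then $\Phi_X^{M_{m^n}}(w)=\Phi_X^{M_{m^n}}(w')$.
   Context: A rack is a set $X$ with a binary operation $\triangleright: X\times X\to X$ such that (1) for all $y\in X$ the map $\beta_y(x)=x\triangleright y$ is a bijection of $X$, with $\beta_y^{-1}(x)$ denoted $x\triangleright^{-1}y$; and (2) $(x\triangleright y)\triangleright z=(x\triangleright z)\triangleright(y\triangleright z)$ for all $x,y,z\in X$. The $n$-braid group $B_n$ is generated by $\sigma_1,\dots,\sigma_{n-1}$ with relations $\sigma_i\sigma_j=\sigma_j\sigma_i$ for $|i-j|\ge 2$ and $\sigma_i\sigma_{i+1}\sigma_i=\sigma_{i+1}\sigma_i\sigma_{i+1}$ for $1\le i\le n-2$. An $n$-braid (isotopy class of geometric braids) is an element of $B_n$. Braid diagrams are encoded by braid words in the $\sigma_i^{\pm1}$, read from left to right as crossings from top to bottom; two words (diagrams) represent the same $n$-braid iff they are equal in $B_n$, equivalently iff the diagrams are related by braid Reidemeister moves II, III and planar isotopies preserving monotonicity and endpoints. Coloring rule: colors in $X$ of the $n$ top endpoints propagate down through a braid word. At a crossing $\sigma_i$, if the colors in positions $(i,i+1)$ above the crossing are $(x,y)$, then below they are $(y,\,x\triangleright y)$; at a crossing $\sigma_i^{-1}$, if the colors in positions $(i,i+1)$ above are $(y,x)$, then below they are $(x\triangleright^{-1}y,\,y)$;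 the colors in all other positions are unchanged. Thus a top coloring in $X^n$ extends to a unique bottom coloring in $X^n$. For a finite rack $X$ with $|X|=m$ and a braid word $w$ on $n$ strands, the rack counting matrix $\Phi_X^{M_{m^n}}(w)$ is the $m^n\times m^n$ matrix with rows and columns indexed by $X^n$, whose $(i,j)$-entry ($i,j\in X^n$) is $1$ if the top coloring $i$ extends through $w$ to the bottom coloring $j$, and $0$ otherwise. *)

theory Defs
  imports "HOL-Algebra.Group" "HOL-Library.FuncSet"
begin

locale rack =
  fixes X :: "'a set" and rop :: "'a \<Rightarrow> 'a \<Rightarrow> 'a"
  assumes bij_right: "y \<in> X \<Longrightarrow> bij_betw (\<lambda>x. rop x y) X X"
    and self_distrib: "x \<in> X \<Longrightarrow> y \<in> X \<Longrightarrow> z \<in> X \<Longrightarrow>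
      rop (rop x y) z = rop (rop x z) (rop y z)"

definition rack_inv_op :: "'a set \<Rightarrow> ('a \<Rightarrow> 'a \<Rightarrow> 'a) \<Rightarrow> 'a \<Rightarrow> 'a \<Rightarrow> 'a" where
  "rack_inv_op X rop x y = inv_into X (\<lambda>z. rop z y) x"

text \<open>\<open>Pos i\<close> stands for the generator \<open>\<sigma>\<^sub>i\<close> and \<open>Neg i\<close> for its inverse; indices start at 1.\<close>

datatype braid_letter = Pos nat | Neg nat

type_synonym braid_word = "braid_letter list"

definition braid_words :: "nat \<Rightarrow> braid_word set" where
  "braid_words n = lists (Pos ` {1..<n} \<union> Neg ` {1..<n})"

text \<open>
  The group presented by the braid relations is the quotient of the words in the generators and
  their formal inverses by the least congruence that contains the braid relations and the
  cancellation of a generator against its inverse.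
\<close>

inductive braid_eq :: "nat \<Rightarrow> braid_word \<Rightarrow> braid_word \<Rightarrow> bool" for n :: nat where
  refl: "w \<in> braid_words n \<Longrightarrow> braid_eq n w w"
| sym: "braid_eq n u v \<Longrightarrow> braid_eq n v u"
| trans: "braid_eq n u v \<Longrightarrow> braid_eq n v w \<Longrightarrow> braid_eq n u w"
| append: "braid_eq n u u' \<Longrightarrow> braid_eq n v v' \<Longrightarrow> braid_eq n (u @ v) (u' @ v')"
| cancel_right: "i \<in> {1..<n} \<Longrightarrow> braid_eq n [Pos i, Neg i] []"
| cancel_left: "i \<in> {1..<n} \<Longrightarrow> braid_eq n [Neg i, Pos i] []"
| far_commute: "i \<in> {1..<n} \<Longrightarrow> j \<in> {1..<n} \<Longrightarrow> \<bar>int i - int j\<bar> \<ge> 2 \<Longrightarrow>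
    braid_eq n [Pos i, Pos j] [Pos j, Pos i]"
| braid: "1 \<le> i \<Longrightarrow> i + 2 \<le> n \<Longrightarrow>
    braid_eq n [Pos i, Pos (i + 1), Pos i] [Pos (i + 1), Pos i, Pos (i + 1)]"

definition braid_rel :: "nat \<Rightarrow> (braid_word \<times> braid_word) set" where
  "braid_rel n = {(u, v). braid_eq n u v}"

definition braid_of :: "nat \<Rightarrow> braid_word \<Rightarrow> braid_word set" where
  "braid_of n w = braid_rel n `` {w}"

definition braid_group :: "nat \<Rightarrow> braid_word set monoid" where
  "braid_group n =
    \<lparr>carrier = braid_words n // braid_rel n,
     mult = (\<lambda>A B. \<Union>u\<in>A. \<Union>v\<in>B. braid_of n (u @ v)),
     one = braid_of n []\<rparr>"

lemma braid_eq_words: "braid_eq n u v \<Longrightarrow> u \<in> braid_words n \<and> v \<in> braid_words n"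
  by (induction rule: braid_eq.induct) (auto simp: braid_words_def)

lemma equiv_braid_rel: "equiv (braid_words n) (braid_rel n)"
proof (rule equivI)
  show "braid_rel n \<subseteq> braid_words n \<times> braid_words n"
    by (auto simp: braid_rel_def dest: braid_eq_words)
  show "refl_on (braid_words n) (braid_rel n)"
    by (rule refl_onI) (simp add: braid_rel_def braid_eq.refl)
  show "sym_on UNIV (braid_rel n)"
    by (rule symI) (simp add: braid_rel_def braid_eq.sym)
  show "trans_on UNIV (braid_rel n)"
    by (rule transI) (simp add: braid_rel_def, rule braid_eq.trans)
qed

lemma braid_of_in_carrier: "w \<in> braid_words n \<Longrightarrow> braid_of n w \<in> carrier (braid_group n)"
  by (auto simp: braid_group_def braid_of_def intro: quotientI)

lemma braid_of_eq_iff: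
  "u \<in> braid_words n \<Longrightarrow> v \<in> braid_words n \<Longrightarrow> braid_of n u = braid_of n v \<longleftrightarrow> braid_eq n u v"
  unfolding braid_of_def using eq_equiv_class_iff[OF equiv_braid_rel] by (auto simp: braid_rel_def)

lemma braid_group_cases:
  assumes "B \<in> carrier (braid_group n)"
  obtains w where "w \<in> braid_words n" "B = braid_of n w"
  using assms by (auto simp: braid_group_def braid_of_def elim: quotientE)

lemma mult_braid_of:
  assumes "u \<in> braid_words n" "v \<in> braid_words n"
  shows "braid_of n u \<otimes>\<^bsub>braid_group n\<^esub> braid_of n v = braid_of n (u @ v)"
proof -
  have "braid_of n (u' @ v') = braid_of n (u @ v)"
    if "u' \<in> braid_of n u" "v' \<in> braid_of n v" for u' v'
  proof -
    have "braid_eq n (u @ v) (u' @ v')"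
      using that by (auto simp: braid_of_def braid_rel_def intro: braid_eq.append)
    then show ?thesis
      using braid_of_eq_iff braid_eq_words by metis
  qed
  moreover have "u \<in> braid_of n u" "v \<in> braid_of n v"
    using assms by (auto simp: braid_of_def braid_rel_def intro: braid_eq.refl)
  ultimately have "(\<Union>u'\<in>braid_of n u. \<Union>v'\<in>braid_of n v. braid_of n (u' @ v')) = braid_of n (u @ v)"
    by blast
  then show ?thesis
    by (simp add: braid_group_def)
qed

lemma braid_words_append:
  "u \<in> braid_words n \<Longrightarrow> v \<in> braid_words n \<Longrightarrow> u @ v \<in> braid_words n"
  by (auto simp: braid_words_def)

lemma braid_left_inverse:
  "w \<in> braid_words n \<Longrightarrow> \<exists>w'\<in>braid_words n. braid_eq n (w' @ w) []"
proof (induction w)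
  case Nil
  then show ?case by (auto intro: braid_eq.refl)
next
  case (Cons a w)
  then have w: "w \<in> braid_words n" by (auto simp: braid_words_def)
  then obtain w' where w': "w' \<in> braid_words n" "braid_eq n (w' @ w) []"
    using Cons.IH by blast
  obtain b where b: "[b] \<in> braid_words n" "braid_eq n [b, a] []"
  proof (cases a)
    case (Pos i)
    then show thesis
      using Cons.prems by (intro that[of "Neg i"])
        (auto simp: braid_words_def intro: braid_eq.cancel_left)
  next
    case (Neg i)
    then show thesis
      using Cons.prems by (intro that[of "Pos i"])
        (auto simp: braid_words_def intro: braid_eq.cancel_right)
  qed
  have "braid_eq n (w' @ ([b, a] @ w)) (w' @ ([] @ w))"
    using b w w' by (intro braid_eq.append braid_eq.refl)
  then have "braid_eq n ((w' @ [b]) @ a # w) []"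
    using w'(2) by (simp add: braid_eq.trans)
  then show ?case
    using b(1) w'(1) braid_words_append by blast
qed

lemma group_braid_group: "group (braid_group n)"
proof (rule groupI)
  have one: "\<one>\<^bsub>braid_group n\<^esub> = braid_of n []" and nil: "[] \<in> braid_words n"
    by (simp_all add: braid_group_def braid_words_def)
  show "\<one>\<^bsub>braid_group n\<^esub> \<in> carrier (braid_group n)"
    by (simp add: one nil braid_of_in_carrier)
  fix A assume A: "A \<in> carrier (braid_group n)"
  then obtain u where u: "u \<in> braid_words n" "A = braid_of n u" by (rule braid_group_cases)
  show "\<one>\<^bsub>braid_group n\<^esub> \<otimes>\<^bsub>braid_group n\<^esub> A = A"
    using u nil by (simp add: one mult_braid_of)
  obtain u' where "u' \<in> braid_words n" "braid_eq n (u' @ u) []"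
    using braid_left_inverse u(1) by blast
  then show "\<exists>A'\<in>carrier (braid_group n). A' \<otimes>\<^bsub>braid_group n\<^esub> A = \<one>\<^bsub>braid_group n\<^esub>"
    using u nil
    by (intro bexI[of _ "braid_of n u'"])
      (auto simp: one mult_braid_of braid_of_eq_iff braid_words_append braid_of_in_carrier)
  fix B assume B: "B \<in> carrier (braid_group n)"
  then obtain v where v: "v \<in> braid_words n" "B = braid_of n v" by (rule braid_group_cases)
  show "A \<otimes>\<^bsub>braid_group n\<^esub> B \<in> carrier (braid_group n)"
    using u v by (simp add: mult_braid_of braid_words_append braid_of_in_carrier)
  fix C assume C: "C \<in> carrier (braid_group n)"
  then obtain w where w: "w \<in> braid_words n" "C = braid_of n w" by (rule braid_group_cases)
  show "A \<otimes>\<^bsub>braid_group n\<^esub> B \<otimes>\<^bsub>braid_group n\<^esub> C = A \<otimes>\<^bsub>braid_group n\<^esub> (B \<otimes>\<^bsub>braid_group n\<^esub> C)"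
    using u v w by (simp add: mult_braid_of braid_words_append)
qed

text \<open>Colorings of the \<open>n\<close> endpoints at one level of a diagram; position \<open>k\<close> carries the color \<open>c k\<close>.\<close>

definition colorings :: "'a set \<Rightarrow> nat \<Rightarrow> (nat \<Rightarrow> 'a) set" where
  "colorings X n = {1..n} \<rightarrow>\<^sub>E X"

lemma card_colorings: "card (colorings X n) = card X ^ n"
  by (simp add: colorings_def card_PiE)

fun color_crossing ::
  "'a set \<Rightarrow> ('a \<Rightarrow> 'a \<Rightarrow> 'a) \<Rightarrow> braid_letter \<Rightarrow> (nat \<Rightarrow> 'a) \<Rightarrow> nat \<Rightarrow> 'a" where
  "color_crossing X rop (Pos i) c = c(i := c (i + 1), i + 1 := rop (c i) (c (i + 1)))"
| "color_crossing X rop (Neg i) c = c(i := rack_inv_op X rop (c (i + 1)) (c i), i + 1 := c i)"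

text \<open>Words are read from the top of the diagram to the bottom, so the head acts first.\<close>

definition bottom_coloring ::
  "'a set \<Rightarrow> ('a \<Rightarrow> 'a \<Rightarrow> 'a) \<Rightarrow> braid_word \<Rightarrow> (nat \<Rightarrow> 'a) \<Rightarrow> nat \<Rightarrow> 'a" where
  "bottom_coloring X rop w c = fold (color_crossing X rop) w c"

text \<open>
  Matrices with rows and columns indexed by \<open>X\<^sup>n\<close> are functions of two arguments that are
  restricted to the index set, so that equality of functions is equality of all the entries.
\<close>

definition rack_counting_matrix ::
  "'a set \<Rightarrow> ('a \<Rightarrow> 'a \<Rightarrow> 'a) \<Rightarrow> nat \<Rightarrow> braid_word \<Rightarrow> (nat \<Rightarrow> 'a) \<Rightarrow> (nat \<Rightarrow> 'a) \<Rightarrow> int" where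
  "rack_counting_matrix X rop n w =
    (\<lambda>i\<in>colorings X n. \<lambda>j\<in>colorings X n. if bottom_coloring X rop w i = j then 1 else 0)"

lemma (in rack) color_crossing_in_colorings:
  assumes "a \<in> Pos ` {1..<n} \<union> Neg ` {1..<n}" and "c \<in> colorings X n"
  shows "color_crossing X rop a c \<in> colorings X n"
proof -
  have op_closed: "rop x y \<in> X" if "x \<in> X" "y \<in> X" for x y
    using bij_betwE[OF bij_right[OF that(2)]] that(1) by blast
  have inv_closed: "rack_inv_op X rop x y \<in> X" if "x \<in> X" "y \<in> X" for x y
    unfolding rack_inv_op_def
    using bij_betw_imp_surj_on[OF bij_right[OF that(2)]] that(1) by (intro inv_into_into) simp
  obtain i where i: "i \<in> {1..n}" "i + 1 \<in> {1..n}" and a: "a = Pos i \<or> a = Neg i"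
    using assms(1) by auto
  have ci: "c i \<in> X" "c (i + 1) \<in> X"
    using assms(2) i unfolding colorings_def by (blast dest: PiE_mem)+
  have upd: "c(i := x, i + 1 := y) \<in> colorings X n" if "x \<in> X" "y \<in> X" for x y
    using assms(2) i that by (simp add: colorings_def PiE_def extensional_def Pi_def)
  show ?thesis
    using a ci by (elim disjE) (simp_all add: upd op_closed inv_closed del: One_nat_def)
qed

lemma (in rack) bottom_coloring_in_colorings:
  "w \<in> braid_words n \<Longrightarrow> c \<in> colorings X n \<Longrightarrow> bottom_coloring X rop w c \<in> colorings X n"
proof (induction w arbitrary: c)
  case Nil
  then show ?case by (simp add: bottom_coloring_def)
next
  case (Cons a w)
  have "color_crossing X rop a c \<in> colorings X n"
    using Cons.prems by (intro color_crossing_in_colorings) (auto simp: braid_words_def)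
  then show ?case
    using Cons by (simp add: bottom_coloring_def braid_words_def)
qed

end

theory Submission
  imports Defs
begin

text \<open>The matrix of \<open>w\<close> is the graph of the map on \<open>colorings X n\<close>
  sending a top coloring to its bottom coloring, so it suffices that this map depends only on the
  class of \<open>w\<close>. Each braid relation is matched by a rack property: cancellation (move
  II) by bijectivity of right translations, the braid relation (move III) by self-distributivity.
  \<open>braid_eq_bottom_coloring\<close> carries this from the relations to all of
  \<open>braid_eq\<close>.\<close>

lemma (in rack) rack_inv_op_rop:
  assumes "x \<in> X" and "y \<in> X"
  shows "rack_inv_op X rop (rop x y) y = x"
  unfolding rack_inv_op_def
  using bij_betw_inv_into_left[OF bij_right[OF assms(2)] assms(1)] .

lemma (in rack) rop_rack_inv_op:
  assumes "x \<in> X" and "y \<in> X"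
  shows "rop (rack_inv_op X rop x y) y = x"
  unfolding rack_inv_op_def
  using bij_betw_inv_into_right[OF bij_right[OF assms(2)] assms(1)] .

lemma colorings_mem: "c \<in> colorings X n \<Longrightarrow> 1 \<le> k \<Longrightarrow> k \<le> n \<Longrightarrow> c k \<in> X"
  by (auto simp: colorings_def)

text \<open>Induction on the derivation of \<open>braid_eq\<close>, with \<open>c\<close> kept
  arbitrary since in a concatenation the lower word starts from a different coloring.\<close>

lemma (in rack) braid_eq_bottom_coloring:
  assumes "braid_eq n u v" and "c \<in> colorings X n"
  shows "bottom_coloring X rop u c = bottom_coloring X rop v c"
  using assms
proof (induction arbitrary: c rule: braid_eq.induct)
  case (append u u' v v')
  \<comment> \<open>Needed so that the coloring below \<open>u\<close> still has its colors in
    \<open>X\<close>, where the hypothesis for \<open>v\<close> and \<open>v'\<close>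
    applies.\<close>
  have "u \<in> braid_words n"
    using append.hyps(1) braid_eq_words by blast
  then have "bottom_coloring X rop v (bottom_coloring X rop u c)
      = bottom_coloring X rop v' (bottom_coloring X rop u c)"
    by (intro append.IH(2) bottom_coloring_in_colorings append.prems)
  then show ?case
    using append.IH(1)[OF append.prems] by (simp add: bottom_coloring_def)
next
  case (cancel_right i)
  then have "c i \<in> X" "c (i + 1) \<in> X"
    by (auto intro: colorings_mem)
  then show ?case
    by (auto simp: bottom_coloring_def rack_inv_op_rop)
next
  case (cancel_left i)
  then have "c i \<in> X" "c (i + 1) \<in> X"
    by (auto intro: colorings_mem)
  then show ?case
    by (auto simp: bottom_coloring_def rop_rack_inv_op)
next
  case (far_commute i j)
  \<comment> \<open>The crossings touch the disjoint position pairs \<open>i, i + 1\<close> and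
    \<open>j, j + 1\<close>.\<close>
  then have "i \<noteq> j" "i \<noteq> j + 1" "j \<noteq> i + 1"
    by auto
  then show ?case
    by (auto simp: bottom_coloring_def fun_eq_iff)
next
  case (braid i)
  then have "c i \<in> X" "c (i + 1) \<in> X" "c (i + 2) \<in> X"
    by (auto intro: colorings_mem)
  \<comment> \<open>With colors \<open>x, y, z\<close> on top, both sides end in \<open>z\<close>,
    \<open>rop y z\<close> and a third color; these equal the two sides of
    self-distributivity.\<close>
  then have "rop (rop (c i) (c (i + 1))) (c (i + 2))
      = rop (rop (c i) (c (i + 2))) (rop (c (i + 1)) (c (i + 2)))"
    by (rule self_distrib)
  then show ?case
    by (simp add: bottom_coloring_def fun_eq_iff)
qed simp_all

theorem theorem5p8:
  fixes X :: "'a set" and rop :: "'a \<Rightarrow> 'a \<Rightarrow> 'a" and m n :: nat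
    and B :: "braid_word set" and w w' :: braid_word
  assumes "rack X rop" and "finite X" and "card X = m"
    and "n \<ge> 1"
    and "B \<in> carrier (braid_group n)"
    and "w \<in> braid_words n" and "braid_of n w = B"
    and "w' \<in> braid_words n" and "braid_of n w' = B"
  shows "rack_counting_matrix X rop n w = rack_counting_matrix X rop n w'"
proof -
  have "braid_eq n w w'"
    using assms(6-9) braid_of_eq_iff by blast
  then have "bottom_coloring X rop w c = bottom_coloring X rop w' c" if "c \<in> colorings X n" for c
    using rack.braid_eq_bottom_coloring[OF assms(1)] that by blast
  then show ?thesis
    unfolding rack_counting_matrix_def by (intro restrict_ext) simp
qed

end
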